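(* Let $\mathcal{P}\subset\mathbb{R}^d$ be a lattice polytope, $\lambda\in\mathbb{Z}^d$ an integral form $\lambda(\mathbf m)=\sum_j\lambda_jm_j$ that is generic and positive with respect to $\mathcal P$, and $\mathbf v$ a vertex of $\mathcal P$. Then each pole of the rational function $\rho_{\mathbf v}^\lambda(q)$ is an $n$th root of unity, where $n=|\lambda(g(\mathbf w-\mathbf v))|$ for some vertex $\mathbf w$ adjacent to $\mathbf v$.
   Context: A lattice polytope is the convex hull of finitely many points of $\mathbb{Z}^d$; two vertices are adjacent if they form an edge. $\lambda$ is generic and positive w.r.t. $\mathcal P$ if $\lambda(\mathbf v)\ne\lambda(\mathbf w)$ for adjacent vertices and $\lambda(\mathbf v)\ge0$ for all vertices. For $\mathbf m\in\mathbb{Z}^d\setminus\{0\}$, $g(\mathbf m)$ denotes $\mathbf m$ divided by the gcd of its entries. Let $\mathcal K_{\mathbf v}=\sum_{\mathbf w\text{ adjacent to }\mathbf v}\mathbb{R}_{\ge0}(\mathbf w-\mathbf v)$, let $\sigma_{\mathcal K}(\mathbf z)=\sum_{\mathbf m\in\mathcal K\cap\mathbb{Z}^d}\mathbf z^{\mathbf m}$ (a rational function for a rational cone), and $\rho_{\mathbf v}^\lambda(q)=\sigma_{\mathcal K_{\mathbf v}}(q^{\lambda_1},\dots,q^{\lambda_d})$. *)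

theory Defs
  imports "HOL-Complex_Analysis.Complex_Analysis" "HOL-Library.Poly_Mapping"
begin

section \<open>Lattice polytopes\<close>

definition of_int_vec :: "int ^ 'n \<Rightarrow> real ^ 'n" where
  "of_int_vec m = (\<chi> i. of_int (m $ i))"

definition lattice_polytope :: "(real ^ 'n) set \<Rightarrow> bool" where
  "lattice_polytope P \<longleftrightarrow> (\<exists>V. finite V \<and> P = convex hull (of_int_vec ` V))"

text \<open>Every vertex of a lattice polytope is a lattice point (lemma
  \<open>lattice_polytope_vertex\<close> below), so vertices are represented by integer vectors.\<close>

definition is_vertex :: "(real ^ 'n) set \<Rightarrow> int ^ 'n \<Rightarrow> bool" where
  "is_vertex P v \<longleftrightarrow> of_int_vec v extreme_point_of P"

definition adjacent :: "(real ^ 'n) set \<Rightarrow> int ^ 'n \<Rightarrow> int ^ 'n \<Rightarrow> bool" where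
  "adjacent P v w \<longleftrightarrow> is_vertex P v \<and> is_vertex P w \<and>
     closed_segment (of_int_vec v) (of_int_vec w) edge_of P"

lemma lattice_polytope_vertex:
  assumes "lattice_polytope P" "x extreme_point_of P"
  obtains v where "x = of_int_vec v" "is_vertex P v"
proof -
  obtain V where "P = convex hull (of_int_vec ` V)"
    using assms(1) by (auto simp: lattice_polytope_def)
  then have "x \<in> of_int_vec ` V"
    using assms(2) extreme_point_of_convex_hull by blast
  then show thesis
    using assms(2) that by (auto simp: is_vertex_def)
qed

section \<open>Integral forms\<close>

definition int_form :: "int ^ 'n \<Rightarrow> int ^ 'n \<Rightarrow> int" where
  "int_form l m = (\<Sum>j\<in>UNIV. l $ j * m $ j)"

definition generic_positive :: "int ^ 'n \<Rightarrow> (real ^ 'n) set \<Rightarrow> bool" where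
  "generic_positive l P \<longleftrightarrow>
     (\<forall>v w. adjacent P v w \<longrightarrow> int_form l v \<noteq> int_form l w) \<and>
     (\<forall>v. is_vertex P v \<longrightarrow> int_form l v \<ge> 0)"

definition primitive_vec :: "int ^ 'n \<Rightarrow> int ^ 'n" where
  "primitive_vec m = (\<chi> i. m $ i div Gcd (range (\<lambda>j. m $ j)))"

section \<open>Vertex cones\<close>

text \<open>The cone is translated so that its apex is the origin.\<close>

definition vertex_cone :: "(real ^ 'n) set \<Rightarrow> int ^ 'n \<Rightarrow> (real ^ 'n) set" where
  "vertex_cone P v =
     {x. \<exists>c. (\<forall>w. adjacent P v w \<longrightarrow> (0::real) \<le> c w) \<and>
             x = (\<Sum>w | adjacent P v w. c w *\<^sub>R (of_int_vec w - of_int_vec v))}"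

section \<open>Generating functions of lattice points\<close>

text \<open>A Laurent polynomial in the variables $z_j$, $j \in$ \<open>'n\<close>, is a finitely supported family of
  coefficients \<^typ>\<open>(int ^ 'n) \<Rightarrow>\<^sub>0 complex\<close>; a formal Laurent series, infinite in
  all directions, is an arbitrary family \<^typ>\<open>int ^ 'n \<Rightarrow> complex\<close>. Such series cannot
  be multiplied with each other, but they form a module over the Laurent polynomials.\<close>

definition laurent_eval :: "((int ^ 'n) \<Rightarrow>\<^sub>0 complex) \<Rightarrow> complex ^ 'n \<Rightarrow> complex" where
  "laurent_eval f z =
     (\<Sum>m\<in>Poly_Mapping.keys f. Poly_Mapping.lookup f m * (\<Prod>j\<in>UNIV. (z $ j) powi (m $ j)))"

definition laurent_times ::
    "((int ^ 'n) \<Rightarrow>\<^sub>0 complex) \<Rightarrow> (int ^ 'n \<Rightarrow> complex) \<Rightarrow> int ^ 'n \<Rightarrow> complex" where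
  "laurent_times g S =
     (\<lambda>m. \<Sum>k\<in>Poly_Mapping.keys g. Poly_Mapping.lookup g k * S (m - k))"

definition lattice_series :: "(real ^ 'n) set \<Rightarrow> int ^ 'n \<Rightarrow> complex" where
  "lattice_series K = (\<lambda>m. if of_int_vec m \<in> K then 1 else 0)"

text \<open>The formal series of \<open>K\<close> equals the rational function $f/g$ if $g \cdot$ series $= f$. The value
  of this rational function at \<open>z\<close> is $f(z)/g(z)$ for any such \<open>f\<close> and \<open>g\<close> with $g(z) \neq 0$; by
  lemma \<open>sigma_eqI\<close> below it does not depend on the choice of \<open>f\<close> and \<open>g\<close>. At points with a zero
  coordinate and at points where no such \<open>g\<close> exists, the value is meaningless.\<close>

definition represents ::
    "((int ^ 'n) \<Rightarrow>\<^sub>0 complex) \<Rightarrow> ((int ^ 'n) \<Rightarrow>\<^sub>0 complex) \<Rightarrow> (real ^ 'n) set \<Rightarrow> bool" where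
  "represents f g K \<longleftrightarrow> g \<noteq> 0 \<and> laurent_times g (lattice_series K) = Poly_Mapping.lookup f"

definition sigma :: "(real ^ 'n) set \<Rightarrow> complex ^ 'n \<Rightarrow> complex" where
  "sigma K z = (THE c. \<exists>f g. represents f g K \<and> laurent_eval g z \<noteq> 0 \<and>
                             c = laurent_eval f z / laurent_eval g z)"

definition rho :: "(real ^ 'n) set \<Rightarrow> int ^ 'n \<Rightarrow> int ^ 'n \<Rightarrow> complex \<Rightarrow> complex" where
  "rho P l v q = sigma (vertex_cone P v) (\<chi> j. q powi (l $ j))"

lemma laurent_eval_superset:
  assumes "finite M" "Poly_Mapping.keys f \<subseteq> M"
  shows "laurent_eval f z =
     (\<Sum>m\<in>M. Poly_Mapping.lookup f m * (\<Prod>j\<in>UNIV. (z $ j) powi (m $ j)))"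
  unfolding laurent_eval_def using assms
  by (intro sum.mono_neutral_left) (auto simp: in_keys_iff)

lemma laurent_eval_mult_eq:
  fixes f h :: "(int ^ 'n) \<Rightarrow>\<^sub>0 complex" and z :: "complex ^ 'n"
  assumes z: "\<And>j. z $ j \<noteq> 0"
    and M: "finite M" "\<And>k m. k \<in> Poly_Mapping.keys h \<Longrightarrow> m \<in> Poly_Mapping.keys f \<Longrightarrow> m + k \<in> M"
  shows "laurent_eval h z * laurent_eval f z =
     (\<Sum>m\<in>M. laurent_times h (Poly_Mapping.lookup f) m * (\<Prod>j\<in>UNIV. (z $ j) powi (m $ j)))"
proof -
  let ?e = "\<lambda>m. \<Prod>j\<in>UNIV. (z $ j) powi (m $ j)"
  have e_add: "?e (m + k) = ?e k * ?e m" for m k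
    using z by (simp add: power_int_add prod.distrib mult.commute)
  have shift: "(\<Sum>m\<in>M. Poly_Mapping.lookup f (m - k) * ?e m) = ?e k * laurent_eval f z"
    if k: "k \<in> Poly_Mapping.keys h" for k
  proof -
    have "(\<Sum>m\<in>M. Poly_Mapping.lookup f (m - k) * ?e m)
        = (\<Sum>m\<in>(\<lambda>m. m + k) ` Poly_Mapping.keys f. Poly_Mapping.lookup f (m - k) * ?e m)"
    proof (rule sum.mono_neutral_right)
      show "\<forall>m\<in>M - (\<lambda>m. m + k) ` Poly_Mapping.keys f. Poly_Mapping.lookup f (m - k) * ?e m = 0"
      proof
        fix m assume "m \<in> M - (\<lambda>m. m + k) ` Poly_Mapping.keys f"
        then have "m - k \<notin> Poly_Mapping.keys f"
          by (metis DiffD2 diff_add_cancel image_eqI)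
        then show "Poly_Mapping.lookup f (m - k) * ?e m = 0"
          by (simp add: in_keys_iff)
      qed
    qed (use M k in auto)
    also have "\<dots> = (\<Sum>m\<in>Poly_Mapping.keys f. Poly_Mapping.lookup f m * ?e (m + k))"
      by (subst sum.reindex) (auto simp: inj_on_def)
    also have "\<dots> = ?e k * laurent_eval f z"
      unfolding e_add laurent_eval_def sum_distrib_left by (simp add: mult_ac)
    finally show ?thesis .
  qed
  have "(\<Sum>m\<in>M. laurent_times h (Poly_Mapping.lookup f) m * ?e m)
      = (\<Sum>k\<in>Poly_Mapping.keys h. Poly_Mapping.lookup h k *
           (\<Sum>m\<in>M. Poly_Mapping.lookup f (m - k) * ?e m))"
    unfolding laurent_times_def sum_distrib_left sum_distrib_right
    by (subst sum.swap) (simp add: mult_ac)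
  also have "\<dots> = (\<Sum>k\<in>Poly_Mapping.keys h. Poly_Mapping.lookup h k * (?e k * laurent_eval f z))"
    using shift by simp
  also have "\<dots> = laurent_eval h z * laurent_eval f z"
    unfolding laurent_eval_def[of h] sum_distrib_right by (simp add: mult_ac)
  finally show ?thesis ..
qed

lemma laurent_times_commute:
  "laurent_times g (laurent_times h S) = laurent_times h (laurent_times g S)"
proof
  fix m
  show "laurent_times g (laurent_times h S) m = laurent_times h (laurent_times g S) m"
    unfolding laurent_times_def sum_distrib_left
    by (subst sum.swap) (simp add: mult_ac diff_diff_eq add.commute)
qed

lemma sigma_unique:
  fixes z :: "complex ^ 'n"
  assumes z: "\<And>j. z $ j \<noteq> 0"
    and "represents f g K" "represents f' g' K"
  shows "laurent_eval g' z * laurent_eval f z = laurent_eval g z * laurent_eval f' z"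
proof -
  let ?M = "(\<lambda>(m, k). m + k) `
      (Poly_Mapping.keys f \<times> Poly_Mapping.keys g' \<union> Poly_Mapping.keys f' \<times> Poly_Mapping.keys g)"
  have "laurent_times g' (Poly_Mapping.lookup f) = laurent_times g (Poly_Mapping.lookup f')"
    using assms(2,3) laurent_times_commute unfolding represents_def by metis
  moreover have "finite ?M" by simp
  ultimately show ?thesis
    by (subst (1 2) laurent_eval_mult_eq[where M = ?M]) (force simp: z)+
qed

lemma sigma_eqI:
  fixes z :: "complex ^ 'n"
  assumes z: "\<And>j. z $ j \<noteq> 0"
    and r: "represents f g K" and g: "laurent_eval g z \<noteq> 0"
  shows "sigma K z = laurent_eval f z / laurent_eval g z"
  unfolding sigma_def
proof (rule the_equality)
  fix c assume "\<exists>f g. represents f g K \<and> laurent_eval g z \<noteq> 0 \<and>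
                             c = laurent_eval f z / laurent_eval g z"
  then obtain f' g' where "represents f' g' K" "laurent_eval g' z \<noteq> 0"
    and c: "c = laurent_eval f' z / laurent_eval g' z" by blast
  then show "c = laurent_eval f z / laurent_eval g z"
    using sigma_unique[OF z r, of f' g'] g by (simp add: frac_eq_eq mult.commute)
qed (use r g in blast)

end

theory Submission
  imports Defs
begin

text \<open>A cone with generators $u_i$ is a disjoint union of relatively open simplicial cones spanned by
  subsets of the generators. The series of such a cell is a sum over the lattice points of the
  box $\{\sum_{i \in T} c_i u_i : 0 < c_i \le 1\}$, divided by $\prod_{i \in T} (1 - z^{u_i})$. Over
  the common denominator $\prod_i (1 - z^{u_i})$ every exponent $m$ of the numerator satisfies
  $\lambda(m) \ge \sum_i \min(0, \lambda(u_i))$. Substituting $z_j = q^{\lambda_j}$ and expanding by a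
  power of $q$ gives a quotient of polynomials with denominator
  $\prod_i \pm(1 - q^{|\lambda(u_i)|})$; in particular there is no pole at $0$.\<close>

section \<open>Decomposition of a finitely generated cone\<close>

text \<open>A series that may be infinite in all directions cannot be divided by $1 - z^{u_i}$, so
  every identity is kept multiplied out: a Laurent polynomial acting on the series gives a Laurent
  polynomial. Cells are disjoint so that their indicator functions add up without correction terms.
  The numbers \<lambda>(u_i) can be negative although \<lambda> is nonnegative on the vertices, and
  0 is no root of unity, so the behaviour at q = 0 has to be controlled. For nonzero \<lambda>(u_i),
  the order of the product of all $1 - q^{\<lambda>(u_i)}$ at q = 0 is exactly the sum of min(0,
  \<lambda>(u_i)); this is where the lower bound for the numerator comes from.\<close>

definition gen_cone :: "('i \<Rightarrow> 'a::real_vector) \<Rightarrow> 'i set \<Rightarrow> 'a set" where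
  "gen_cone u I = {x. \<exists>c. (\<forall>i\<in>I. 0 \<le> c i) \<and> x = (\<Sum>i\<in>I. c i *\<^sub>R u i)}"

definition open_cone :: "('i \<Rightarrow> 'a::real_vector) \<Rightarrow> 'i set \<Rightarrow> 'a set" where
  "open_cone u T = {x. \<exists>c. (\<forall>i\<in>T. 0 < c i) \<and> x = (\<Sum>i\<in>T. c i *\<^sub>R u i)}"

text \<open>Independence of the indexed family, not of the set of its values: a repeated vector
  counts as a dependence. Coefficients in a cell are thus unique even when \<open>u\<close> is not
  injective.\<close>

definition lin_indep :: "('i \<Rightarrow> 'a::real_vector) \<Rightarrow> 'i set \<Rightarrow> bool" where
  "lin_indep u T \<longleftrightarrow> (\<forall>c. (\<Sum>i\<in>T. c i *\<^sub>R u i) = 0 \<longrightarrow> (\<forall>i\<in>T. c i = 0))"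

lemma gen_coneI: "(\<And>i. i \<in> I \<Longrightarrow> 0 \<le> c i) \<Longrightarrow> (\<Sum>i\<in>I. c i *\<^sub>R u i) \<in> gen_cone u I"
  unfolding gen_cone_def by blast

lemma open_coneI: "(\<And>i. i \<in> T \<Longrightarrow> 0 < c i) \<Longrightarrow> (\<Sum>i\<in>T. c i *\<^sub>R u i) \<in> open_cone u T"
  unfolding open_cone_def by blast

lemma open_coneE:
  assumes "x \<in> open_cone u T"
  obtains c where "\<And>i. i \<in> T \<Longrightarrow> 0 < c i" "x = (\<Sum>i\<in>T. c i *\<^sub>R u i)"
  using assms unfolding open_cone_def by blast

lemma gen_cone_add:
  assumes "x \<in> gen_cone u I" "y \<in> gen_cone u I"
  shows "x + y \<in> gen_cone u I"
proof -
  obtain c d where "\<forall>i\<in>I. 0 \<le> c i" "\<forall>i\<in>I. 0 \<le> d i"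
    "x = (\<Sum>i\<in>I. c i *\<^sub>R u i)" "y = (\<Sum>i\<in>I. d i *\<^sub>R u i)"
    using assms unfolding gen_cone_def by blast
  then show ?thesis
    using gen_coneI[of I "\<lambda>i. c i + d i" u] by (simp add: scaleR_add_left sum.distrib)
qed

lemma gen_cone_scaleR:
  assumes "x \<in> gen_cone u I" "0 \<le> a"
  shows "a *\<^sub>R x \<in> gen_cone u I"
proof -
  obtain c where "\<forall>i\<in>I. 0 \<le> c i" "x = (\<Sum>i\<in>I. c i *\<^sub>R u i)"
    using assms unfolding gen_cone_def by blast
  then show ?thesis
    using assms gen_coneI[of I "\<lambda>i. a * c i" u] by (simp add: scaleR_sum_right)
qed

lemma generator_in_gen_cone:
  assumes "finite I" "j \<in> I"
  shows "u j \<in> gen_cone u I"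
proof -
  have "(\<Sum>i\<in>I. (if i = j then 1 else 0 :: real) *\<^sub>R u i) = (\<Sum>i\<in>I. if i = j then u i else 0)"
    by (intro sum.cong) auto
  also have "\<dots> = u j"
    using assms by simp
  finally show ?thesis
    using gen_coneI[of I "\<lambda>i. if i = j then 1 else 0" u] by simp
qed

lemma zero_in_gen_cone: "0 \<in> gen_cone u I"
  using gen_coneI[of I "\<lambda>_. 0" u] by simp

lemma sum_in_gen_cone:
  assumes "finite T" "\<And>i. i \<in> T \<Longrightarrow> x i \<in> gen_cone u I"
  shows "(\<Sum>i\<in>T. x i) \<in> gen_cone u I"
  using assms by (induction rule: finite_induct) (auto intro: zero_in_gen_cone gen_cone_add)

lemma gen_cone_mono:
  assumes "finite J" "I \<subseteq> J"
  shows "gen_cone u I \<subseteq> gen_cone u J"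
proof
  fix x assume "x \<in> gen_cone u I"
  then obtain c where c: "\<forall>i\<in>I. 0 \<le> c i" "x = (\<Sum>i\<in>I. c i *\<^sub>R u i)"
    unfolding gen_cone_def by blast
  show "x \<in> gen_cone u J"
    unfolding c(2) using assms c(1) finite_subset[OF assms(2,1)]
    by (intro sum_in_gen_cone gen_cone_scaleR generator_in_gen_cone) auto
qed

lemma open_cone_subset_gen_cone: "open_cone u T \<subseteq> gen_cone u T"
  unfolding open_cone_def gen_cone_def using less_imp_le by blast

text \<open>Serves to inherit closedness of finitely generated convex cones, on which the minimal
  \<open>a\<close> in the triangulation rests.\<close>

lemma gen_cone_eq_hull:
  assumes "finite I"
  shows "gen_cone u I = convex_cone hull (u ` I)"
proof
  show "gen_cone u I \<subseteq> convex_cone hull (u ` I)"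
  proof
    fix x assume "x \<in> gen_cone u I"
    then obtain c where c: "\<forall>i\<in>I. 0 \<le> c i" "x = (\<Sum>i\<in>I. c i *\<^sub>R u i)"
      unfolding gen_cone_def by blast
    have "(\<Sum>i\<in>J. c i *\<^sub>R u i) \<in> convex_cone hull (u ` I)" if "J \<subseteq> I" for J
      using finite_subset[OF that assms] that
    proof (induction rule: finite_induct)
      case (insert j J)
      then show ?case
        using c(1) by (auto intro!: convex_cone_hull_add convex_cone_hull_mul intro: hull_inc)
    qed (simp add: convex_cone_hull_contains_0)
    then show "x \<in> convex_cone hull (u ` I)"
      using c(2) by blast
  qed
  show "convex_cone hull (u ` I) \<subseteq> gen_cone u I"
  proof (rule hull_minimal)
    show "convex_cone (gen_cone u I)"
      unfolding convex_cone_iff by (auto intro: zero_in_gen_cone gen_cone_add gen_cone_scaleR)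
    show "u ` I \<subseteq> gen_cone u I"
      using assms by (auto intro: generator_in_gen_cone)
  qed
qed

lemma closed_gen_cone:
  fixes u :: "'i \<Rightarrow> 'a::euclidean_space"
  shows "finite I \<Longrightarrow> closed (gen_cone u I)"
  by (simp add: gen_cone_eq_hull closed_convex_cone_hull)

lemma gen_cone_insertE:
  assumes "finite I" "j \<notin> I" "x \<in> gen_cone u (insert j I)"
  obtains a where "0 \<le> a" "x - a *\<^sub>R u j \<in> gen_cone u I"
proof -
  obtain c where "\<forall>i\<in>insert j I. 0 \<le> c i" "x = (\<Sum>i\<in>insert j I. c i *\<^sub>R u i)"
    using assms(3) unfolding gen_cone_def by blast
  then show thesis
    using assms(1,2) that[of "c j"] gen_coneI[of I c u] by simp
qed

lemma open_cone_insert: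
  assumes "finite T" "j \<notin> T"
  shows "x \<in> open_cone u (insert j T) \<longleftrightarrow> (\<exists>a>0. x - a *\<^sub>R u j \<in> open_cone u T)"
proof
  assume "x \<in> open_cone u (insert j T)"
  then obtain c where "\<And>i. i \<in> insert j T \<Longrightarrow> 0 < c i" "x = (\<Sum>i\<in>insert j T. c i *\<^sub>R u i)"
    by (rule open_coneE) blast
  then show "\<exists>a>0. x - a *\<^sub>R u j \<in> open_cone u T"
    using assms open_coneI[of T c u] by (intro exI[of _ "c j"]) auto
next
  assume "\<exists>a>0. x - a *\<^sub>R u j \<in> open_cone u T"
  then obtain a where a: "a > 0" "x - a *\<^sub>R u j \<in> open_cone u T"
    by blast
  obtain c where c: "\<And>i. i \<in> T \<Longrightarrow> 0 < c i" "x - a *\<^sub>R u j = (\<Sum>i\<in>T. c i *\<^sub>R u i)"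
    using a(2) by (rule open_coneE) blast
  have "(\<Sum>i\<in>insert j T. (c(j := a)) i *\<^sub>R u i) = a *\<^sub>R u j + (\<Sum>i\<in>T. (c(j := a)) i *\<^sub>R u i)"
    using assms by simp
  also have "(\<Sum>i\<in>T. (c(j := a)) i *\<^sub>R u i) = (\<Sum>i\<in>T. c i *\<^sub>R u i)"
    using assms by (intro sum.cong) auto
  finally have "x = (\<Sum>i\<in>insert j T. (c(j := a)) i *\<^sub>R u i)"
    using c(2) by (simp add: algebra_simps)
  moreover have "0 < (c(j := a)) i" if "i \<in> insert j T" for i
    using that a(1) c(1) by auto
  ultimately show "x \<in> open_cone u (insert j T)"
    unfolding open_cone_def by blast
qed

text \<open>All coefficients of \<open>x\<close> are positive, so a small multiple of
  \<open>y\<close> can be subtracted; the smallest ratio of coefficients bounds it. This is what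
  spreads visibility from one point of a cell to all others.\<close>

lemma open_cone_absorbs:
  assumes "finite T" "x \<in> open_cone u T" "y \<in> open_cone u T"
  obtains d where "d > 0" "x - d *\<^sub>R y \<in> gen_cone u T"
proof -
  obtain c where c: "\<And>i. i \<in> T \<Longrightarrow> 0 < c i" "x = (\<Sum>i\<in>T. c i *\<^sub>R u i)"
    using assms(2) by (rule open_coneE) blast
  obtain b where b: "\<And>i. i \<in> T \<Longrightarrow> 0 < b i" "y = (\<Sum>i\<in>T. b i *\<^sub>R u i)"
    using assms(3) by (rule open_coneE) blast
  define d where "d = Min (insert 1 ((\<lambda>i. c i / b i) ` T))"
  have "d > 0"
    unfolding d_def using assms(1) b(1) c(1) by (subst Min_gr_iff) auto
  moreover have "0 \<le> c i - d * b i" if "i \<in> T" for i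
  proof -
    have "d \<le> c i / b i"
      unfolding d_def using assms(1) that by (intro Min_le) auto
    then show ?thesis
      using b(1)[OF that] by (simp add: field_simps)
  qed
  then have "(\<Sum>i\<in>T. (c i - d * b i) *\<^sub>R u i) \<in> gen_cone u T"
    by (rule gen_coneI)
  then have "x - d *\<^sub>R y \<in> gen_cone u T"
    unfolding b(2) c(2) by (simp add: scaleR_diff_left sum_subtractf scaleR_sum_right)
  ultimately show thesis
    by (rule that)
qed

text \<open>Induction on the generators. A point outside the cone of \<open>I\<close> is \<open>y + a *\<^sub>R u j\<close> with \<open>a\<close>
  minimal such that \<open>y\<close> lies in that cone; then \<open>y\<close> belongs to a cell visible from the direction
  \<open>u j\<close>, and visibility (the set \<open>V\<close>) is a property of the whole cell.\<close>

lemma gen_cone_triangulation: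
  fixes u :: "'i \<Rightarrow> 'a::euclidean_space"
  assumes "finite I"
  obtains F where "F \<subseteq> Pow I" "\<And>T. T \<in> F \<Longrightarrow> lin_indep u T"
    "gen_cone u I = (\<Union>T\<in>F. open_cone u T)" "disjoint_family_on (open_cone u) F"
proof -
  have "\<exists>F\<subseteq>Pow I. (\<forall>T\<in>F. lin_indep u T) \<and> gen_cone u I = (\<Union>T\<in>F. open_cone u T) \<and>
         disjoint_family_on (open_cone u) F"
    using assms
  proof (induction rule: finite_induct)
    case empty
    have "gen_cone u {} = {0}" "open_cone u {} = {0}" "lin_indep u {}"
      by (auto simp: gen_cone_def open_cone_def lin_indep_def)
    then show ?case
      by (intro exI[of _ "{{}}"]) (auto simp: disjoint_family_on_def)
  next
    case (insert j I)
    then obtain F where F: "F \<subseteq> Pow I" "\<And>T. T \<in> F \<Longrightarrow> lin_indep u T"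
      "gen_cone u I = (\<Union>T\<in>F. open_cone u T)" "disjoint_family_on (open_cone u) F"
      using insert.IH by metis
    have T: "finite T" "j \<notin> T" "T \<subseteq> I" if "T \<in> F" for T
      using that F(1) insert.hyps finite_subset by blast+
    define V where "V = {T\<in>F. \<forall>y\<in>open_cone u T. \<forall>e>0. y + e *\<^sub>R u j \<notin> gen_cone u I}"
    define F' where "F' = F \<union> insert j ` V"
    have subV: "V \<subseteq> F" by (auto simp: V_def)
    have cone_sub: "open_cone u T \<subseteq> gen_cone u I" if "T \<in> F" for T
      using that F(3) by blast
    have *: "T \<in> V" if "T \<in> F" "y \<in> open_cone u T" and ye: "\<And>e. e > 0 \<Longrightarrow> y + e *\<^sub>R u j \<notin> gen_cone u I" for T y
    proof -
      have "z + e *\<^sub>R u j \<notin> gen_cone u I" if z: "z \<in> open_cone u T" and e: "e > 0" for z e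
      proof
        assume ze: "z + e *\<^sub>R u j \<in> gen_cone u I"
        obtain d where d: "d > 0" "y - d *\<^sub>R z \<in> gen_cone u T"
          using open_cone_absorbs[OF T(1)] \<open>T \<in> F\<close> \<open>y \<in> open_cone u T\<close> z by blast
        \<comment> \<open>The sum equals \<open>y\<close> moved by \<open>d * e\<close> along
          \<open>u j\<close>, so a blocked \<open>z\<close> would make \<open>y\<close> blocked as
          well.\<close>
        have "(y - d *\<^sub>R z) + d *\<^sub>R (z + e *\<^sub>R u j) \<in> gen_cone u I"
          using d ze gen_cone_mono[OF insert.hyps(1) T(3)[OF \<open>T \<in> F\<close>]]
          by (metis gen_cone_add gen_cone_scaleR less_imp_le subsetD)
        then show False
          using ye[of "d * e"] d e by (simp add: algebra_simps)
      qed
      then show ?thesis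
        using that(1) by (simp add: V_def)
    qed
    have outside: "x \<notin> gen_cone u I" if TV: "T \<in> V" and xT: "x \<in> open_cone u (insert j T)" for T x
    proof -
      obtain a where a: "a > 0" "x - a *\<^sub>R u j \<in> open_cone u T"
        using xT open_cone_insert[OF T(1,2)] TV subV by blast
      then have "x - a *\<^sub>R u j + a *\<^sub>R u j \<notin> gen_cone u I"
        using TV unfolding V_def by blast
      then show ?thesis
        by simp
    qed
    have indep: "lin_indep u (insert j T)" if TV: "T \<in> V" for T
      unfolding lin_indep_def
    proof (intro allI impI)
      fix c :: "'i \<Rightarrow> real" assume "(\<Sum>i\<in>insert j T. c i *\<^sub>R u i) = 0"
      have TF: "T \<in> F" using TV subV by blast
      then have rel: "c j *\<^sub>R u j + (\<Sum>i\<in>T. c i *\<^sub>R u i) = 0"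
        using \<open>(\<Sum>i\<in>insert j T. c i *\<^sub>R u i) = 0\<close> T by simp
      have "c j = 0"
      proof (rule ccontr)
        assume "c j \<noteq> 0"
        define b where "b i = - c i / c j" for i
        have "c j *\<^sub>R u j = - (\<Sum>i\<in>T. c i *\<^sub>R u i)"
          using rel by (simp add: eq_neg_iff_add_eq_0)
        then have "(1 / c j) *\<^sub>R c j *\<^sub>R u j = (1 / c j) *\<^sub>R (- (\<Sum>i\<in>T. c i *\<^sub>R u i))"
          by (simp only:)
        then have "u j = (1 / c j) *\<^sub>R (- (\<Sum>i\<in>T. c i *\<^sub>R u i))"
          using \<open>c j \<noteq> 0\<close> by simp
        also have "\<dots> = (\<Sum>i\<in>T. b i *\<^sub>R u i)"
          by (simp add: b_def scaleR_sum_right sum_negf)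
        finally have uj: "u j = (\<Sum>i\<in>T. b i *\<^sub>R u i)" .
        \<comment> \<open>If \<open>u j\<close> lay in the span of the cell, a point with these
          large coefficients could move by \<open>u j\<close> without leaving the cone of
          \<open>T\<close>, since 1 + |b_i| + b_i \<ge> 1. Visibility forbids this.\<close>
        define y where "y = (\<Sum>i\<in>T. (1 + \<bar>b i\<bar>) *\<^sub>R u i)"
        have "y \<in> open_cone u T"
          unfolding y_def by (rule open_coneI) auto
        moreover have "y + 1 *\<^sub>R u j = (\<Sum>i\<in>T. (1 + \<bar>b i\<bar> + b i) *\<^sub>R u i)"
          unfolding y_def by (subst uj) (simp add: sum.distrib scaleR_add_left)
        then have "y + 1 *\<^sub>R u j \<in> gen_cone u T"
          using gen_coneI[of T "\<lambda>i. 1 + \<bar>b i\<bar> + b i" u] by (simp add: abs_if)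
        then have "y + 1 *\<^sub>R u j \<in> gen_cone u I"
          using gen_cone_mono[OF insert.hyps(1) T(3)[OF TF]] by blast
        ultimately show False
          using TV unfolding V_def using zero_less_one by blast
      qed
      then show "\<forall>i\<in>insert j T. c i = 0"
        using rel F(2)[OF TF] by (simp add: lin_indep_def)
    qed
    have "gen_cone u (insert j I) = (\<Union>T\<in>F'. open_cone u T)"
    proof
      show "gen_cone u (insert j I) \<subseteq> (\<Union>T\<in>F'. open_cone u T)"
      proof
        fix x assume x: "x \<in> gen_cone u (insert j I)"
        \<comment> \<open>The ray from \<open>x\<close> in direction \<open>- u j\<close> first
          meets the old cone at the least element of \<open>A\<close>, which exists because the cone
          is closed.\<close>
        define A where "A = {a. 0 \<le> a \<and> x - a *\<^sub>R u j \<in> gen_cone u I}"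
        have "A = {0..} \<inter> (\<lambda>a. x - a *\<^sub>R u j) -` gen_cone u I"
          by (auto simp: A_def)
        moreover have "closed ((\<lambda>a. x - a *\<^sub>R u j) -` gen_cone u I)"
          by (intro continuous_closed_vimage closed_gen_cone insert.hyps continuous_intros)
        ultimately have "closed A"
          by (simp add: closed_Int)
        moreover have "A \<noteq> {}"
          using gen_cone_insertE[OF insert.hyps(1,2) x] by (auto simp: A_def)
        moreover have bdd: "bdd_below A"
          by (auto simp: A_def)
        ultimately have "Inf A \<in> A"
          by (simp add: closed_contains_Inf)
        then have a: "0 \<le> Inf A" "x - Inf A *\<^sub>R u j \<in> gen_cone u I"
          by (auto simp: A_def)
        then obtain T where TF: "T \<in> F" "x - Inf A *\<^sub>R u j \<in> open_cone u T"
          using F(3) by blast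
        show "x \<in> (\<Union>T\<in>F'. open_cone u T)"
        proof (cases "Inf A = 0")
          case True
          then show ?thesis using TF by (auto simp: F'_def)
        next
          case False
          have "x - Inf A *\<^sub>R u j + e *\<^sub>R u j \<notin> gen_cone u I" if "e > 0" for e
          proof
            assume e: "x - Inf A *\<^sub>R u j + e *\<^sub>R u j \<in> gen_cone u I"
            \<comment> \<open>The cap keeps \<open>Inf A - e'\<close> nonnegative. By convexity the
              shorter move also stays in the cone, which puts an element of \<open>A\<close> below
              its infimum.\<close>
            define e' where "e' = min e (Inf A)"
            have e': "0 < e'" "e' \<le> Inf A" "e' \<le> e"
              using False a(1) that by (auto simp: e'_def)
            let ?y = "x - Inf A *\<^sub>R u j"
            have "(1 - e' / e) *\<^sub>R ?y + (e' / e) *\<^sub>R (?y + e *\<^sub>R u j) \<in> gen_cone u I"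
              using that e' by (intro gen_cone_add gen_cone_scaleR e a(2)) auto
            also have "(1 - e' / e) *\<^sub>R ?y + (e' / e) *\<^sub>R (?y + e *\<^sub>R u j) = ?y + e' *\<^sub>R u j"
              using that by (simp add: algebra_simps)
            finally have "Inf A - e' \<in> A"
              using e' by (simp add: A_def algebra_simps)
            then show False
              using cInf_lower[OF _ bdd] e'(1) by fastforce
          qed
          then have "T \<in> V"
            using * TF by blast
          moreover have "x \<in> open_cone u (insert j T)"
            using open_cone_insert[OF T(1,2)[OF TF(1)]] TF(2) a(1) False by (metis order_le_less)
          ultimately show ?thesis
            by (auto simp: F'_def)
        qed
      qed
      have "open_cone u T \<subseteq> gen_cone u (insert j I)" if "T \<in> F'" for T
      proof -
        have "T \<subseteq> insert j I"
          using that T(3) subV by (auto simp: F'_def)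
        then show ?thesis
          using open_cone_subset_gen_cone gen_cone_mono[of "insert j I" T u] insert.hyps(1) by blast
      qed
      then show "(\<Union>T\<in>F'. open_cone u T) \<subseteq> gen_cone u (insert j I)"
        by blast
    qed
    moreover have "disjoint_family_on (open_cone u) F'"
    proof -
      have FF: "T = T'" if "T \<in> F" "T' \<in> F" "x \<in> open_cone u T" "x \<in> open_cone u T'" for T T' x
        using F(4) that unfolding disjoint_family_on_def by blast
      have VV: "T = T'" if V: "T \<in> V" "T' \<in> V" 
        and x: "x \<in> open_cone u (insert j T)" "x \<in> open_cone u (insert j T')" for T T' x
      proof -
        obtain a where a: "x - a *\<^sub>R u j \<in> open_cone u T"
          using x(1) open_cone_insert[OF T(1,2)] V(1) subV by blast
        obtain b where "x - b *\<^sub>R u j \<in> open_cone u T'"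
          using x(2) open_cone_insert[OF T(1,2)] V(2) subV by blast
        note ab = a this
        \<comment> \<open>Stated for arbitrary cells so that it applies in both directions and
          yields \<open>a = b\<close>. If \<open>a > b\<close>, moving by \<open>a - b\<close> along
          \<open>u j\<close> from the point in the cell of \<open>T\<close> reaches a point of the
          old cone, against the visibility of \<open>T\<close>.\<close>
        have le: "a \<le> b" if "x - a *\<^sub>R u j \<in> open_cone u T" "x - b *\<^sub>R u j \<in> open_cone u T'" "T \<in> V" "T' \<in> V" for a b T T'
        proof (rule ccontr)
          assume "\<not> a \<le> b"
          then have "x - a *\<^sub>R u j + (a - b) *\<^sub>R u j \<notin> gen_cone u I"
            using that(1,3) by (simp add: V_def)
          then show False
            using cone_sub[of T'] that(2,4) subV by (auto simp: algebra_simps)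
        qed
        have "a = b"
          using le[OF ab V] le[OF ab(2,1) V(2,1)] by simp
        then show "T = T'"
          using F(4) ab V subV unfolding disjoint_family_on_def by blast
      qed
      have FV: "x \<notin> open_cone u T" if "T \<in> F" "T' \<in> V" "x \<in> open_cone u (insert j T')" for T T' x
        using outside[OF that(2,3)] cone_sub[OF that(1)] by blast
      show ?thesis
        unfolding disjoint_family_on_def
      proof (intro ballI impI, rule ccontr)
        fix S S' assume S: "S \<in> F'" "S' \<in> F'" "S \<noteq> S'" "open_cone u S \<inter> open_cone u S' \<noteq> {}"
        then obtain x where x: "x \<in> open_cone u S" "x \<in> open_cone u S'"
          by blast
        from S(1) show False
          unfolding F'_def
        proof
          assume "S \<in> F"
          with S(2,3) x show False
            unfolding F'_def using FF FV by auto
        next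
          assume "S \<in> insert j ` V"
          then obtain T where "T \<in> V" "S = insert j T"
            by blast
          with S(2,3) x show False
            unfolding F'_def using VV FV by auto
        qed
      qed
    qed
    moreover have "F' \<subseteq> Pow (insert j I)"
      using T(3) subV by (auto simp: F'_def)
    moreover have "\<forall>T\<in>F'. lin_indep u T"
      using F(2) indep by (auto simp: F'_def)
    ultimately show ?case
      by (intro exI[of _ F'] conjI)
  qed
  then obtain F where "F \<subseteq> Pow I \<and> (\<forall>T\<in>F. lin_indep u T) \<and>
      gen_cone u I = (\<Union>T\<in>F. open_cone u T) \<and> disjoint_family_on (open_cone u) F" ..
  then show thesis
    using that[of F] by simp
qed

section \<open>Laurent polynomials acting on series\<close>

lemma laurent_times_superset:
  assumes "finite M" "Poly_Mapping.keys g \<subseteq> M"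
  shows "laurent_times g S m = (\<Sum>k\<in>M. Poly_Mapping.lookup g k * S (m - k))"
  unfolding laurent_times_def using assms
  by (intro sum.mono_neutral_left) (auto simp: in_keys_iff)

lemma laurent_times_one [simp]: "laurent_times 1 S = S"
  by (simp add: laurent_times_def fun_eq_iff lookup_one)

lemma laurent_eval_one [simp]: "laurent_eval 1 z = 1"
  by (simp add: laurent_eval_def lookup_one)

lemma laurent_times_diff:
  "laurent_times (f - g) S m = laurent_times f S m - laurent_times g S m"
proof -
  let ?M = "Poly_Mapping.keys f \<union> Poly_Mapping.keys g"
  have "Poly_Mapping.keys (f - g) \<subseteq> ?M"
    by (rule keys_diff)
  then show ?thesis
    by (simp add: laurent_times_superset[of ?M] lookup_minus left_diff_distrib sum_subtractf)
qed

lemma laurent_eval_diff: "laurent_eval (f - g) z = laurent_eval f z - laurent_eval g z"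
proof -
  let ?M = "Poly_Mapping.keys f \<union> Poly_Mapping.keys g"
  have "Poly_Mapping.keys (f - g) \<subseteq> ?M"
    by (rule keys_diff)
  then show ?thesis
    by (simp add: laurent_eval_superset[of ?M] lookup_minus left_diff_distrib sum_subtractf)
qed

lemma lookup_single_times:
  fixes g :: "'a::ab_group_add \<Rightarrow>\<^sub>0 'b::comm_semiring_1"
  shows "Poly_Mapping.lookup (Poly_Mapping.single k 1 * g) m = Poly_Mapping.lookup g (m - k)"
proof -
  have "(m = k + q) = (q = m - k)" for q
    by (auto simp: algebra_simps)
  then have "(\<Sum>q. Poly_Mapping.lookup g q when m = k + q) = Poly_Mapping.lookup g (m - k)"
    by simp
  then show ?thesis
    by (simp add: lookup_mult lookup_single when_mult)
qed

lemma keys_single_times: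
  fixes g :: "'a::ab_group_add \<Rightarrow>\<^sub>0 'b::comm_semiring_1"
  shows "Poly_Mapping.keys (Poly_Mapping.single k 1 * g) = (\<lambda>m. m + k) ` Poly_Mapping.keys g"
proof (intro set_eqI iffI)
  fix m assume "m \<in> Poly_Mapping.keys (Poly_Mapping.single k 1 * g)"
  then have "m - k \<in> Poly_Mapping.keys g"
    by (simp add: in_keys_iff lookup_single_times)
  then show "m \<in> (\<lambda>m. m + k) ` Poly_Mapping.keys g"
    by (metis diff_add_cancel imageI)
qed (auto simp: in_keys_iff lookup_single_times)

text \<open>Denominators grow by one factor $1 - z^k$ at a time; for a monomial factor,
  compatibility of the product with the action on series is a mere shift.\<close>

lemma laurent_times_single_times:
  "laurent_times (Poly_Mapping.single k 1 * g) S m = laurent_times g S (m - k)"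
  unfolding laurent_times_def keys_single_times lookup_single_times
  by (subst sum.reindex) (auto simp: inj_on_def algebra_simps)

lemma laurent_eval_single_times:
  fixes z :: "complex ^ 'n"
  assumes "\<And>j. z $ j \<noteq> 0"
  shows "laurent_eval (Poly_Mapping.single k 1 * g) z =
    (\<Prod>j\<in>UNIV. (z $ j) powi (k $ j)) * laurent_eval g z"
  unfolding laurent_eval_def keys_single_times lookup_single_times
  by (subst sum.reindex)
    (auto simp: inj_on_def sum_distrib_left power_int_add assms prod.distrib mult_ac)

lemma laurent_times_sum:
  "laurent_times g (\<lambda>m. \<Sum>i\<in>I. S i m) m = (\<Sum>i\<in>I. laurent_times g (S i) m)"
  unfolding laurent_times_def sum_distrib_left by (rule sum.swap)

section \<open>Denominators and lower bounds for the exponents of numerators\<close>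

definition cone_denom :: "('i \<Rightarrow> int ^ 'n) \<Rightarrow> 'i set \<Rightarrow> (int ^ 'n) \<Rightarrow>\<^sub>0 complex" where
  "cone_denom u I = (\<Prod>i\<in>I. 1 - Poly_Mapping.single (u i) 1)"

lemma cone_denom_empty [simp]: "cone_denom u {} = 1"
  by (simp add: cone_denom_def)

lemma cone_denom_insert:
  assumes "finite I" "i \<notin> I"
  shows "cone_denom u (insert i I) = cone_denom u I - Poly_Mapping.single (u i) 1 * cone_denom u I"
  using assms by (simp add: cone_denom_def left_diff_distrib)

lemma laurent_times_cone_denom_insert:
  assumes "finite I" "i \<notin> I"
  shows "laurent_times (cone_denom u (insert i I)) S m =
    laurent_times (cone_denom u I) S m - laurent_times (cone_denom u I) S (m - u i)"
  using assms by (simp add: cone_denom_insert laurent_times_diff laurent_times_single_times)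

lemma laurent_eval_cone_denom:
  fixes z :: "complex ^ 'n"
  assumes "finite I" "\<And>j. z $ j \<noteq> 0"
  shows "laurent_eval (cone_denom u I) z = (\<Prod>i\<in>I. 1 - (\<Prod>j\<in>UNIV. (z $ j) powi (u i $ j)))"
  using assms(1)
proof (induction rule: finite_induct)
  case (insert i I)
  then show ?case
    using assms(2)
    by (simp add: cone_denom_insert laurent_eval_diff laurent_eval_single_times left_diff_distrib)
qed simp

text \<open>Finite support makes \<open>S\<close> a Laurent polynomial, and \<open>b\<close> bounds
  from below its order at q = 0 after the substitution $z_j = q^{\<lambda>_j}$. It is phrased for
  plain families because numerators first arise as products with series.\<close>

definition supported_above :: "int ^ 'n \<Rightarrow> int \<Rightarrow> (int ^ 'n \<Rightarrow> complex) \<Rightarrow> bool" where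
  "supported_above l b S \<longleftrightarrow> finite {m. S m \<noteq> 0} \<and> (\<forall>m. S m \<noteq> 0 \<longrightarrow> b \<le> int_form l m)"

lemma int_form_diff: "int_form l (m - k) = int_form l m - int_form l k"
  by (simp add: int_form_def algebra_simps sum_subtractf)

text \<open>The shift raises every exponent by \<open>k\<close>, so the bound gets worse only if
  \<lambda>(k) is negative.\<close>

lemma supported_above_shift_diff:
  assumes "supported_above l b S"
  shows "supported_above l (b + min 0 (int_form l k)) (\<lambda>m. S m - S (m - k))"
proof -
  have "{m. S m - S (m - k) \<noteq> 0} \<subseteq> {m. S m \<noteq> 0} \<union> (\<lambda>m. m + k) ` {m. S m \<noteq> 0}"
  proof
    fix m assume "m \<in> {m. S m - S (m - k) \<noteq> 0}"
    then have "S m \<noteq> 0 \<or> S (m - k) \<noteq> 0" by auto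
    moreover have "m = (m - k) + k" by simp
    ultimately show "m \<in> {m. S m \<noteq> 0} \<union> (\<lambda>m. m + k) ` {m. S m \<noteq> 0}"
      by blast
  qed
  moreover have "finite ({m. S m \<noteq> 0} \<union> (\<lambda>m. m + k) ` {m. S m \<noteq> 0})"
    using assms by (simp add: supported_above_def)
  moreover have "b + min 0 (int_form l k) \<le> int_form l m" if "S m - S (m - k) \<noteq> 0" for m
  proof -
    have "S m \<noteq> 0 \<or> S (m - k) \<noteq> 0" using that by auto
    then have "b \<le> int_form l m \<or> b \<le> int_form l (m - k)"
      using assms by (auto simp: supported_above_def)
    then show ?thesis by (auto simp: int_form_diff)
  qed
  ultimately show ?thesis
    unfolding supported_above_def by (simp add: finite_subset)
qed

lemma supported_above_sum:
  assumes "finite F" "\<And>T. T \<in> F \<Longrightarrow> supported_above l b (S T)"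
  shows "supported_above l b (\<lambda>m. \<Sum>T\<in>F. S T m)"
proof -
  have *: "\<exists>T\<in>F. S T m \<noteq> 0" if "(\<Sum>T\<in>F. S T m) \<noteq> 0" for m
    using that by (meson sum.neutral)
  have "finite {m. (\<Sum>T\<in>F. S T m) \<noteq> 0}"
    by (rule finite_subset[of _ "\<Union>T\<in>F. {m. S T m \<noteq> 0}"])
      (use * assms in \<open>auto simp: supported_above_def\<close>)
  then show ?thesis
    using * assms(2) unfolding supported_above_def by blast
qed

text \<open>Brings a cell with generators \<open>T\<close> to the common denominator:
  \<open>A\<close> holds the generators that are missing, and each new factor $1 - z^{u_j}$ costs at
  most min(0, \<lambda>(u_j)). Disjointness keeps a factor from being counted twice.\<close>

lemma supported_above_cone_denom:
  assumes "finite A" "finite T" "A \<inter> T = {}"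
    and "supported_above l (\<Sum>i\<in>T. min 0 (int_form l (u i))) (laurent_times (cone_denom u T) S)"
  shows "supported_above l (\<Sum>i\<in>A \<union> T. min 0 (int_form l (u i)))
           (laurent_times (cone_denom u (A \<union> T)) S)"
  using assms(1,3)
proof (induction rule: finite_induct)
  case (insert j A)
  then have "supported_above l ((\<Sum>i\<in>A \<union> T. min 0 (int_form l (u i))) + min 0 (int_form l (u j)))
    (\<lambda>m. laurent_times (cone_denom u (A \<union> T)) S m - laurent_times (cone_denom u (A \<union> T)) S (m - u j))"
    by (intro supported_above_shift_diff) auto
  moreover have "laurent_times (cone_denom u (insert j A \<union> T)) S =
    (\<lambda>m. laurent_times (cone_denom u (A \<union> T)) S m - laurent_times (cone_denom u (A \<union> T)) S (m - u j))"
    using insert assms(2) laurent_times_cone_denom_insert[of "A \<union> T" j u S] by auto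
  ultimately show ?case
    using insert assms(2) by (simp add: add.commute)
qed (use assms(4) in simp)

section \<open>Series of cones\<close>

text \<open>Multiplying the series of a simplicial open cone by $1 - z^{u_j}$ turns the condition
  $0 < c_j$ on the $j$-th coordinate into $0 < c_j \le 1$. Here \<open>A\<close> is the set of coordinates already
  treated.\<close>

definition half_open_cone :: "('i \<Rightarrow> 'a::real_vector) \<Rightarrow> 'i set \<Rightarrow> 'i set \<Rightarrow> 'a set" where
  "half_open_cone u T A =
    {x. \<exists>c. (\<forall>i\<in>T. 0 < c i) \<and> (\<forall>i\<in>A. c i \<le> 1) \<and> x = (\<Sum>i\<in>T. c i *\<^sub>R u i)}"

lemma half_open_cone_empty: "half_open_cone u T {} = open_cone u T"
  by (simp add: half_open_cone_def open_cone_def)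

lemma lin_indep_unique:
  assumes "lin_indep u T" "(\<Sum>i\<in>T. c i *\<^sub>R u i) = (\<Sum>i\<in>T. d i *\<^sub>R u i)" "i \<in> T"
  shows "c i = d i"
proof -
  have "(\<Sum>i\<in>T. (c i - d i) *\<^sub>R u i) = 0"
    using assms(2) by (simp add: scaleR_diff_left sum_subtractf)
  then show ?thesis
    using assms(1,3) unfolding lin_indep_def by (metis eq_iff_diff_eq_0)
qed

lemma sum_scaleR_fun_upd:
  fixes u :: "'i \<Rightarrow> 'a::real_vector"
  assumes "finite T" "j \<in> T"
  shows "(\<Sum>i\<in>T. (c(j := a)) i *\<^sub>R u i) = (\<Sum>i\<in>T. c i *\<^sub>R u i) + (a - c j) *\<^sub>R u j"
proof -
  have "(\<Sum>i\<in>T - {j}. (c(j := a)) i *\<^sub>R u i) = (\<Sum>i\<in>T - {j}. c i *\<^sub>R u i)"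
    by (intro sum.cong) auto
  then have upd: "(\<Sum>i\<in>T. (c(j := a)) i *\<^sub>R u i) = a *\<^sub>R u j + (\<Sum>i\<in>T - {j}. c i *\<^sub>R u i)"
    using sum.remove[OF assms, of "\<lambda>i. (c(j := a)) i *\<^sub>R u i"] by simp
  have orig: "(\<Sum>i\<in>T. c i *\<^sub>R u i) = c j *\<^sub>R u j + (\<Sum>i\<in>T - {j}. c i *\<^sub>R u i)"
    using assms by (rule sum.remove)
  show ?thesis
    unfolding upd orig scaleR_diff_left by simp
qed

text \<open>With \<open>j \<notin> A\<close> the coordinate at \<open>j\<close> has no upper bound
  and may be raised by 1. Hence the translate by \<open>u j\<close> is a subset, and the difference
  of the two indicator series is again an indicator series.\<close>

lemma half_open_cone_add:
  assumes "finite T" "j \<in> T" "j \<notin> A" "x - u j \<in> half_open_cone u T A"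
  shows "x \<in> half_open_cone u T A"
proof -
  obtain c where c: "\<forall>i\<in>T. 0 < c i" "\<forall>i\<in>A. c i \<le> 1" "x - u j = (\<Sum>i\<in>T. c i *\<^sub>R u i)"
    using assms(4) unfolding half_open_cone_def by blast
  have "x = (\<Sum>i\<in>T. (c(j := c j + 1)) i *\<^sub>R u i)"
    unfolding sum_scaleR_fun_upd[OF assms(1,2)] using c(3) by (simp add: algebra_simps)
  moreover have "\<forall>i\<in>T. 0 < (c(j := c j + 1)) i" "\<forall>i\<in>A. (c(j := c j + 1)) i \<le> 1"
    using c assms by (auto intro: add_pos_pos)
  ultimately show ?thesis
    unfolding half_open_cone_def by blast
qed

text \<open>Independence makes the coordinate at \<open>j\<close> well defined. Subtracting
  \<open>u j\<close> lowers it by 1, so it ceases to be positive exactly when it was at most 1; this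
  is why the box is closed at 1 and open at 0.\<close>

lemma half_open_cone_insert:
  assumes "finite T" "lin_indep u T" "j \<in> T" "j \<notin> A" "A \<subseteq> T"
  shows "x \<in> half_open_cone u T (insert j A) \<longleftrightarrow>
    x \<in> half_open_cone u T A \<and> x - u j \<notin> half_open_cone u T A"
proof
  assume "x \<in> half_open_cone u T (insert j A)"
  then obtain c where c: "\<forall>i\<in>T. 0 < c i" "\<forall>i\<in>insert j A. c i \<le> 1" "x = (\<Sum>i\<in>T. c i *\<^sub>R u i)"
    unfolding half_open_cone_def by blast
  have "x - u j \<notin> half_open_cone u T A"
  proof
    assume "x - u j \<in> half_open_cone u T A"
    then obtain d where d: "\<forall>i\<in>T. 0 < d i" "x - u j = (\<Sum>i\<in>T. d i *\<^sub>R u i)"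
      unfolding half_open_cone_def by blast
    have "(\<Sum>i\<in>T. (d(j := d j + 1)) i *\<^sub>R u i) = (\<Sum>i\<in>T. c i *\<^sub>R u i)"
      unfolding sum_scaleR_fun_upd[OF assms(1,3)] using d(2) c(3) by (simp add: algebra_simps)
    then have "(d(j := d j + 1)) j = c j"
      using lin_indep_unique[OF assms(2) _ assms(3)] by blast
    then show False
      using c(2) d(1) assms(3) by force
  qed
  moreover have "x \<in> half_open_cone u T A"
    unfolding half_open_cone_def using c by blast
  ultimately show "x \<in> half_open_cone u T A \<and> x - u j \<notin> half_open_cone u T A"
    by simp
next
  assume x: "x \<in> half_open_cone u T A \<and> x - u j \<notin> half_open_cone u T A"
  then obtain c where c: "\<forall>i\<in>T. 0 < c i" "\<forall>i\<in>A. c i \<le> 1" "x = (\<Sum>i\<in>T. c i *\<^sub>R u i)"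
    unfolding half_open_cone_def by blast
  have "c j \<le> 1"
  proof (rule ccontr)
    assume "\<not> c j \<le> 1"
    then have "\<forall>i\<in>T. 0 < (c(j := c j - 1)) i" "\<forall>i\<in>A. (c(j := c j - 1)) i \<le> 1"
      using c assms(4) by auto
    moreover have "x - u j = (\<Sum>i\<in>T. (c(j := c j - 1)) i *\<^sub>R u i)"
      unfolding sum_scaleR_fun_upd[OF assms(1,3)] using c(3) by simp
    ultimately show False
      using x unfolding half_open_cone_def by blast
  qed
  then show "x \<in> half_open_cone u T (insert j A)"
    unfolding half_open_cone_def using c by blast
qed

lemma of_int_vec_diff: "of_int_vec (m - k) = of_int_vec m - of_int_vec k"
  by (simp add: of_int_vec_def vec_eq_iff)

lemma inner_of_int_vec: "of_int_vec l \<bullet> of_int_vec m = of_int (int_form l m)"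
  by (simp add: of_int_vec_def inner_vec_def int_form_def)

lemma laurent_times_simplicial_cone:
  fixes u :: "'i \<Rightarrow> int ^ 'n"
  defines "U \<equiv> \<lambda>i. of_int_vec (u i)"
  assumes "finite T" "lin_indep U T" "A \<subseteq> T"
  shows "laurent_times (cone_denom u A) (lattice_series (open_cone U T)) =
    lattice_series (half_open_cone U T A)"
  using finite_subset[OF assms(4,2)] assms(4)
proof (induction rule: finite_induct)
  case (insert j A)
  show ?case
  proof
    fix m
    have "lattice_series (half_open_cone U T A) m - lattice_series (half_open_cone U T A) (m - u j) =
      lattice_series (half_open_cone U T (insert j A)) m"
      using half_open_cone_insert[OF assms(2,3), of j A "of_int_vec m"] insert.hyps insert.prems
        half_open_cone_add[OF assms(2), of j A "of_int_vec m" U]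
      by (auto simp: lattice_series_def of_int_vec_diff U_def)
    then show "laurent_times (cone_denom u (insert j A)) (lattice_series (open_cone U T)) m =
      lattice_series (half_open_cone U T (insert j A)) m"
      using insert by (simp add: laurent_times_cone_denom_insert)
  qed
qed (simp add: half_open_cone_empty)

lemma finite_int_box: "finite {m :: int ^ 'n. \<forall>k. \<bar>m $ k\<bar> \<le> b k}"
proof (rule finite_subset)
  show "{m :: int ^ 'n. \<forall>k. \<bar>m $ k\<bar> \<le> b k} \<subseteq>
    vec_lambda ` (\<Pi>\<^sub>E k\<in>UNIV. {- b k..b k})"
  proof
    fix m :: "int ^ 'n" assume "m \<in> {m. \<forall>k. \<bar>m $ k\<bar> \<le> b k}"
    then have "($) m \<in> (\<Pi>\<^sub>E k\<in>UNIV. {- b k..b k})"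
      by (auto simp: abs_le_iff) (metis minus_le_iff)
    moreover have "m = vec_lambda (($) m)"
      by simp
    ultimately show "m \<in> vec_lambda ` (\<Pi>\<^sub>E k\<in>UNIV. {- b k..b k})"
      by blast
  qed
qed (simp add: finite_PiE)

text \<open>Coefficients 0 < c_i \<le> 1 bound every entry of a lattice point of the box, hence
  finiteness. They also give c_i \<lambda>(u_i) \<ge> min(0, \<lambda>(u_i)), where c_i \<le> 1
  handles the negative values.\<close>

lemma supported_above_half_open_box:
  fixes u :: "'i \<Rightarrow> int ^ 'n"
  assumes "finite T"
  shows "supported_above l (\<Sum>i\<in>T. min 0 (int_form l (u i)))
    (lattice_series (half_open_cone (\<lambda>i. of_int_vec (u i)) T T))"
proof -
  let ?B = "half_open_cone (\<lambda>i. of_int_vec (u i) :: real ^ 'n) T T"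
  have rep: "\<exists>c. (\<forall>i\<in>T. 0 < c i \<and> c i \<le> 1) \<and> of_int_vec m = (\<Sum>i\<in>T. c i *\<^sub>R of_int_vec (u i) :: real ^ 'n)"
    if "of_int_vec m \<in> ?B" for m
    using that unfolding half_open_cone_def by blast
  have "{m. lattice_series ?B m \<noteq> 0} \<subseteq> {m. \<forall>k. \<bar>m $ k\<bar> \<le> (\<Sum>i\<in>T. \<bar>u i $ k\<bar>)}"
  proof (intro subsetI CollectI allI)
    fix m k assume "m \<in> {m. lattice_series ?B m \<noteq> 0}"
    then have "of_int_vec m \<in> ?B"
      by (simp add: lattice_series_def split: if_splits)
    then obtain c where c: "\<forall>i\<in>T. 0 < c i \<and> c i \<le> 1"
      "of_int_vec m = (\<Sum>i\<in>T. c i *\<^sub>R of_int_vec (u i) :: real ^ 'n)"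
      using rep by blast
    have "real_of_int (m $ k) = (\<Sum>i\<in>T. c i * of_int (u i $ k))"
      using arg_cong[OF c(2), of "\<lambda>x. x $ k"] by (simp add: of_int_vec_def)
    also have "\<bar>\<dots>\<bar> \<le> (\<Sum>i\<in>T. \<bar>c i * of_int (u i $ k)\<bar>)"
      by (rule sum_abs)
    also have "\<dots> \<le> (\<Sum>i\<in>T. \<bar>of_int (u i $ k)\<bar>)"
      using c(1) by (intro sum_mono) (auto simp: abs_mult intro!: mult_left_le_one_le)
    finally show "\<bar>m $ k\<bar> \<le> (\<Sum>i\<in>T. \<bar>u i $ k\<bar>)"
      by (simp flip: of_int_abs of_int_sum)
  qed
  then have "finite {m. lattice_series ?B m \<noteq> 0}"
    by (rule finite_subset) (rule finite_int_box)
  moreover have "(\<Sum>i\<in>T. min 0 (int_form l (u i))) \<le> int_form l m"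
    if "lattice_series ?B m \<noteq> 0" for m
  proof -
    have "of_int_vec m \<in> ?B"
      using that by (simp add: lattice_series_def split: if_splits)
    then obtain c where c: "\<forall>i\<in>T. 0 < c i \<and> c i \<le> 1"
      "of_int_vec m = (\<Sum>i\<in>T. c i *\<^sub>R of_int_vec (u i) :: real ^ 'n)"
      using rep by blast
    have "real_of_int (\<Sum>i\<in>T. min 0 (int_form l (u i))) = (\<Sum>i\<in>T. min 0 (real_of_int (int_form l (u i))))"
      by (simp add: of_int_min)
    also have "\<dots> \<le> (\<Sum>i\<in>T. c i * real_of_int (int_form l (u i)))"
    proof (rule sum_mono)
      fix i assume "i \<in> T"
      then have c: "0 < c i" "c i \<le> 1" using c(1) by auto
      show "min 0 (real_of_int (int_form l (u i))) \<le> c i * real_of_int (int_form l (u i))"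
      proof (cases "int_form l (u i) \<ge> 0")
        case False
        then have "1 * real_of_int (int_form l (u i)) \<le> c i * real_of_int (int_form l (u i))"
          using c by (intro mult_right_mono_neg) auto
        then show ?thesis by simp
      qed (use c in simp)
    qed
    also have "\<dots> = of_int_vec l \<bullet> of_int_vec m"
      unfolding c(2) by (simp add: inner_sum_right inner_of_int_vec)
    finally show ?thesis
      by (simp only: inner_of_int_vec of_int_le_iff)
  qed
  ultimately show ?thesis
    by (simp add: supported_above_def)
qed

lemma lattice_series_gen_cone:
  fixes u :: "'i \<Rightarrow> int ^ 'n"
  assumes "finite I"
  obtains f where
    "laurent_times (cone_denom u I) (lattice_series (gen_cone (\<lambda>i. of_int_vec (u i)) I)) =
       Poly_Mapping.lookup f"
    "\<And>m. m \<in> Poly_Mapping.keys f \<Longrightarrow> (\<Sum>i\<in>I. min 0 (int_form l (u i))) \<le> int_form l m"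
proof -
  define U where "U = (\<lambda>i. of_int_vec (u i) :: real ^ 'n)"
  obtain F where F: "F \<subseteq> Pow I" "\<And>T. T \<in> F \<Longrightarrow> lin_indep U T"
    "gen_cone U I = (\<Union>T\<in>F. open_cone U T)" "disjoint_family_on (open_cone U) F"
    using gen_cone_triangulation[OF assms, of U] by metis
  have "finite F"
    using F(1) assms finite_subset by blast
  let ?S = "laurent_times (cone_denom u I) (lattice_series (gen_cone U I))"
  let ?b = "\<Sum>i\<in>I. min 0 (int_form l (u i))"
  have "lattice_series (gen_cone U I) m = (\<Sum>T\<in>F. lattice_series (open_cone U T) m)" for m
  proof (cases "of_int_vec m \<in> gen_cone U I")
    case True
    then obtain T where T: "T \<in> F" "of_int_vec m \<in> open_cone U T"
      using F(3) by blast
    have "lattice_series (open_cone U T') m = (if T' = T then 1 else 0)" if "T' \<in> F" for T'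
      using F(4) T that by (auto simp: lattice_series_def disjoint_family_on_def)
    then show ?thesis
      using True T(1) \<open>finite F\<close> by (simp add: lattice_series_def)
  next
    case False
    then show ?thesis
      using F(3) by (auto simp: lattice_series_def)
  qed
  then have "lattice_series (gen_cone U I) = (\<lambda>m. \<Sum>T\<in>F. lattice_series (open_cone U T) m)"
    by blast
  then have S: "?S = (\<lambda>m. \<Sum>T\<in>F. laurent_times (cone_denom u I) (lattice_series (open_cone U T)) m)"
    by (simp only: laurent_times_sum[symmetric])
  have "supported_above l ?b ?S"
    unfolding S
  proof (rule supported_above_sum[OF \<open>finite F\<close>])
    fix T assume "T \<in> F"
    then have T: "T \<subseteq> I" "finite T" "lin_indep U T"
      using F(1,2) assms finite_subset by blast+
    have "laurent_times (cone_denom u T) (lattice_series (open_cone U T)) =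
      lattice_series (half_open_cone U T T)"
      using laurent_times_simplicial_cone[of T u T] T by (simp add: U_def)
    then have "supported_above l (\<Sum>i\<in>(I - T) \<union> T. min 0 (int_form l (u i)))
      (laurent_times (cone_denom u ((I - T) \<union> T)) (lattice_series (open_cone U T)))"
      using supported_above_half_open_box[OF T(2), of l u] assms T(2)
      by (intro supported_above_cone_denom) (auto simp: U_def)
    moreover have "(I - T) \<union> T = I" using T(1) by blast
    ultimately show "supported_above l ?b
      (laurent_times (cone_denom u I) (lattice_series (open_cone U T)))"
      by simp
  qed
  then have S: "finite {m. ?S m \<noteq> 0}" "\<And>m. ?S m \<noteq> 0 \<Longrightarrow> ?b \<le> int_form l m"
    by (auto simp: supported_above_def)
  define f where "f = Abs_poly_mapping ?S"
  have f: "Poly_Mapping.lookup f = ?S"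
    unfolding f_def using S(1) by (rule lookup_Abs_poly_mapping)
  show thesis
    by (rule that[of f]) (use f S(2) in \<open>auto simp: U_def in_keys_iff\<close>)
qed

section \<open>Specialization to one variable\<close>

lemma int_form_powi:
  assumes "(q :: complex) \<noteq> 0"
  shows "(\<Prod>j\<in>UNIV. (q powi (l $ j)) powi (m $ j)) = q powi (int_form l m)"
proof -
  have "(\<Prod>j\<in>J. (q powi (l $ j)) powi (m $ j)) = q powi (\<Sum>j\<in>J. l $ j * m $ j)" if "finite J" for J
    using that by induction (use assms in \<open>auto simp: power_int_add power_int_mult\<close>)
  then show ?thesis
    by (simp add: int_form_def)
qed

text \<open>The numerator is fixed before \<open>q\<close> varies, so the formula describes one
  rational function of \<open>q\<close>. The conditions on \<open>q\<close> make the coordinates of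
  the evaluation point and the denominator nonzero.\<close>

lemma sigma_gen_cone:
  fixes u :: "'i \<Rightarrow> int ^ 'n"
  assumes "finite I"
  obtains f where
    "\<forall>m\<in>Poly_Mapping.keys f. (\<Sum>i\<in>I. min 0 (int_form l (u i))) \<le> int_form l m"
    "\<forall>q. q \<noteq> 0 \<longrightarrow> (\<forall>i\<in>I. q powi (int_form l (u i)) \<noteq> 1) \<longrightarrow>
      sigma (gen_cone (\<lambda>i. of_int_vec (u i)) I) (\<chi> j. q powi (l $ j)) =
      (\<Sum>m\<in>Poly_Mapping.keys f. Poly_Mapping.lookup f m * q powi (int_form l m)) /
      (\<Prod>i\<in>I. 1 - q powi (int_form l (u i)))"
proof -
  let ?K = "gen_cone (\<lambda>i. of_int_vec (u i) :: real ^ 'n) I"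
  obtain f where f: "laurent_times (cone_denom u I) (lattice_series ?K) = Poly_Mapping.lookup f"
    "\<And>m. m \<in> Poly_Mapping.keys f \<Longrightarrow> (\<Sum>i\<in>I. min 0 (int_form l (u i))) \<le> int_form l m"
    using lattice_series_gen_cone[OF assms] by metis
  have "sigma ?K (\<chi> j. q powi (l $ j)) =
      (\<Sum>m\<in>Poly_Mapping.keys f. Poly_Mapping.lookup f m * q powi (int_form l m)) /
      (\<Prod>i\<in>I. 1 - q powi (int_form l (u i)))"
    if q: "q \<noteq> 0" "\<And>i. i \<in> I \<Longrightarrow> q powi (int_form l (u i)) \<noteq> 1" for q
  proof -
    let ?z = "(\<chi> j. q powi (l $ j)) :: complex ^ 'n"
    have z: "?z $ j \<noteq> 0" for j
      using q(1) by simp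
    have D: "laurent_eval (cone_denom u I) ?z = (\<Prod>i\<in>I. 1 - q powi (int_form l (u i)))"
      using laurent_eval_cone_denom[OF assms, of ?z u] q(1) by (simp add: int_form_powi)
    then have D0: "laurent_eval (cone_denom u I) ?z \<noteq> 0"
      using q(2) assms by fastforce
    \<comment> \<open>A nonzero value certifies a nonzero Laurent polynomial, as
      \<open>represents\<close> demands.\<close>
    then have "cone_denom u I \<noteq> 0"
      by (auto simp: laurent_eval_def)
    then have "represents f (cone_denom u I) ?K"
      using f(1) by (simp add: represents_def)
    then have "sigma ?K ?z = laurent_eval f ?z / laurent_eval (cone_denom u I) ?z"
      using sigma_eqI z D0 by blast
    then show ?thesis
      unfolding D by (simp add: laurent_eval_def int_form_powi[OF q(1)])
  qed
  then show thesis
    using that f(2) by blast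
qed

text \<open>Otherwise the function agrees near \<open>q0\<close> with a quotient of polynomials
  whose denominator does not vanish at \<open>q0\<close>, so it has a finite limit there. The case
  q0 = 0 is included.\<close>

lemma pole_sigma_gen_cone:
  fixes u :: "'i \<Rightarrow> int ^ 'n"
  assumes "finite I" "\<And>i. i \<in> I \<Longrightarrow> int_form l (u i) \<noteq> 0"
    and "is_pole (\<lambda>q. sigma (gen_cone (\<lambda>i. of_int_vec (u i)) I) (\<chi> j. q powi (l $ j))) q0"
  shows "\<exists>i\<in>I. q0 ^ nat \<bar>int_form l (u i)\<bar> = 1"
proof (rule ccontr)
  assume "\<not> ?thesis"
  then have q0: "q0 ^ nat \<bar>int_form l (u i)\<bar> \<noteq> 1" if "i \<in> I" for i
    using that by blast
  let ?sig = "\<lambda>q. sigma (gen_cone (\<lambda>i. of_int_vec (u i) :: real ^ 'n) I) (\<chi> j. q powi (l $ j))"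
  define a where "a i = int_form l (u i)" for i
  obtain f where f: "\<forall>m\<in>Poly_Mapping.keys f. (\<Sum>i\<in>I. min 0 (a i)) \<le> int_form l m"
    "\<forall>q. q \<noteq> 0 \<longrightarrow> (\<forall>i\<in>I. q powi (a i) \<noteq> 1) \<longrightarrow> ?sig q =
      (\<Sum>m\<in>Poly_Mapping.keys f. Poly_Mapping.lookup f m * q powi (int_form l m)) /
      (\<Prod>i\<in>I. 1 - q powi (a i))"
    unfolding a_def by (rule sigma_gen_cone[OF assms(1), of l u]) blast
  txt \<open>Expanding the fraction by $q^N$ removes all negative exponents, which excludes a pole at $0$.\<close>
  define N where "N = (\<Sum>i\<in>I. nat (- min 0 (a i)))"
  have N: "int N = - (\<Sum>i\<in>I. min 0 (a i))"
    by (simp add: N_def sum_negf)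
  define h where "h q = (\<Sum>m\<in>Poly_Mapping.keys f. Poly_Mapping.lookup f m * q ^ nat (int_form l m + N))" for q
  \<comment> \<open>The factors $1 - q^{a_i}$ cleared of negative powers: for a_i < 0 one has
    $q^{-a_i} (1 - q^{a_i}) = q^{|a_i|} - 1$, hence the change of sign.\<close>
  define D where "D q = (\<Prod>i\<in>I. if a i > 0 then 1 - q ^ nat \<bar>a i\<bar> else q ^ nat \<bar>a i\<bar> - 1)" for q :: complex
  have "isCont (\<lambda>q. if a i > 0 then 1 - q ^ nat \<bar>a i\<bar> else q ^ nat \<bar>a i\<bar> - 1) q0" for i
    by (cases "a i > 0") (auto intro!: continuous_intros)
  then have "isCont D q0"
    unfolding D_def by (intro continuous_prod) auto
  have "(if a i > 0 then 1 - q0 ^ nat \<bar>a i\<bar> else q0 ^ nat \<bar>a i\<bar> - 1) \<noteq> 0" if "i \<in> I" for i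
    using q0[OF that] by (auto simp: a_def)
  then have "D q0 \<noteq> 0"
    using assms(1) unfolding D_def by simp
  have eq: "?sig q = h q / D q" if q: "q \<noteq> 0" "D q \<noteq> 0" for q
  proof -
    have factor: "q ^ nat (- min 0 (a i)) * (1 - q powi (a i)) =
      (if a i > 0 then 1 - q ^ nat \<bar>a i\<bar> else q ^ nat \<bar>a i\<bar> - 1)" if "i \<in> I" for i
      using q(1) assms(2)[OF that]
      by (auto simp: power_int_def a_def min_def right_diff_distrib simp flip: power_mult_distrib)
    have "q powi (a i) \<noteq> 1" if "i \<in> I" for i
      using factor[OF that] q(2) assms(1) that unfolding D_def by fastforce
    then have "?sig q = (\<Sum>m\<in>Poly_Mapping.keys f. Poly_Mapping.lookup f m * q powi (int_form l m)) /
      (\<Prod>i\<in>I. 1 - q powi (a i))"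
      using f(2) q(1) by blast
    also have "\<dots> = (q ^ N * (\<Sum>m\<in>Poly_Mapping.keys f. Poly_Mapping.lookup f m * q powi (int_form l m))) /
      (q ^ N * (\<Prod>i\<in>I. 1 - q powi (a i)))"
      using q(1) by simp
    also have "q ^ N * (\<Prod>i\<in>I. 1 - q powi (a i)) = D q"
      unfolding N_def power_sum D_def prod.distrib[symmetric] by (intro prod.cong refl factor)
    also have "q ^ N * (\<Sum>m\<in>Poly_Mapping.keys f. Poly_Mapping.lookup f m * q powi (int_form l m)) = h q"
      unfolding h_def sum_distrib_left
    proof (rule sum.cong)
      fix m assume "m \<in> Poly_Mapping.keys f"
      \<comment> \<open>The support bound makes this exponent nonnegative, so \<open>nat\<close>
        loses nothing.\<close>
      then have "q ^ nat (int_form l m + N) = q powi (int_form l m + N)"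
        using f(1) N by (simp add: power_int_def)
      also have "\<dots> = q ^ N * q powi (int_form l m)"
        using q(1) by (simp add: power_int_add)
      finally show "q ^ N * (Poly_Mapping.lookup f m * q powi (int_form l m)) =
        Poly_Mapping.lookup f m * q ^ nat (int_form l m + N)"
        by simp
    qed simp
    finally show ?thesis .
  qed
  have "D \<midarrow>q0\<rightarrow> D q0"
    using \<open>isCont D q0\<close> by (simp add: isCont_def)
  then have "eventually (\<lambda>q. D q \<noteq> 0) (at q0)"
    using \<open>D q0 \<noteq> 0\<close> tendsto_imp_eventually_ne by blast
  moreover have "eventually (\<lambda>q. q \<noteq> 0) (at q0)"
    by (rule eventually_neq_at_within)
  ultimately have "eventually (\<lambda>q. ?sig q = h q / D q) (at q0)"
    by eventually_elim (use eq in auto)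
  \<comment> \<open>A pole is a matter of the punctured neighbourhood, so agreement at nonzero
    \<open>q\<close> close to \<open>q0\<close> suffices, also for q0 = 0.\<close>
  then have "is_pole ?sig q0 = is_pole (\<lambda>q. h q / D q) q0"
    by (rule is_pole_cong[OF _ refl])
  then have "is_pole (\<lambda>q. h q / D q) q0"
    using assms(3) by simp
  moreover have "(\<lambda>q. h q / D q) \<midarrow>q0\<rightarrow> h q0 / D q0"
    unfolding h_def by (intro tendsto_intros \<open>D \<midarrow>q0\<rightarrow> D q0\<close> \<open>D q0 \<noteq> 0\<close>)
  ultimately show False
    unfolding is_pole_def using not_tendsto_and_filterlim_at_infinity[of "at q0"] by auto
qed

section \<open>From the vertex cone to primitive edge directions\<close>

lemma gen_cone_rescale:
  assumes "\<And>i. i \<in> I \<Longrightarrow> 0 < d i"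
  shows "gen_cone (\<lambda>i. d i *\<^sub>R u i) I = gen_cone u I"
proof (intro set_eqI iffI)
  fix x assume "x \<in> gen_cone (\<lambda>i. d i *\<^sub>R u i) I"
  then obtain c where "\<forall>i\<in>I. 0 \<le> c i" "x = (\<Sum>i\<in>I. c i *\<^sub>R d i *\<^sub>R u i)"
    unfolding gen_cone_def by blast
  then show "x \<in> gen_cone u I"
    using gen_coneI[of I "\<lambda>i. c i * d i" u] assms by (simp add: less_imp_le)
next
  fix x assume "x \<in> gen_cone u I"
  then obtain c where "\<forall>i\<in>I. 0 \<le> c i" "x = (\<Sum>i\<in>I. c i *\<^sub>R u i)"
    unfolding gen_cone_def by blast
  moreover have "(\<Sum>i\<in>I. (c i / d i) *\<^sub>R d i *\<^sub>R u i) = (\<Sum>i\<in>I. c i *\<^sub>R u i)"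
    using assms by (intro sum.cong) (auto simp: less_imp_neq[symmetric])
  ultimately show "x \<in> gen_cone (\<lambda>i. d i *\<^sub>R u i) I"
    using gen_coneI[of I "\<lambda>i. c i / d i" "\<lambda>i. d i *\<^sub>R u i"] assms by (simp add: less_imp_le)
qed

lemma primitive_vec:
  assumes "m \<noteq> 0"
  obtains d :: int where "d > 0" "\<And>i. m $ i = d * primitive_vec m $ i"
proof
  let ?d = "Gcd (range (\<lambda>j. m $ j))"
  obtain j where "m $ j \<noteq> 0"
    using assms by (auto simp: vec_eq_iff)
  then have "?d \<noteq> 0"
    by (auto simp: Gcd_0_iff)
  then show "?d > 0"
    by (metis Gcd_int_greater_eq_0 order_le_less)
  show "m $ i = ?d * primitive_vec m $ i" for i
    by (simp add: primitive_vec_def dvd_mult_div_cancel)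
qed

text \<open>Neighbours are extreme points of the hull of a finite set and so belong to it.
  Finiteness matters because a sum over an infinite index set is 0 by convention, which would
  collapse \<open>vertex_cone\<close>.\<close>

lemma finite_adjacent:
  fixes P :: "(real ^ 'n) set"
  assumes "lattice_polytope P"
  shows "finite {w. adjacent P v w}"
proof -
  obtain V where V: "finite V" "P = convex hull (of_int_vec ` V)"
    using assms by (auto simp: lattice_polytope_def)
  have "w \<in> V" if "adjacent P v w" for w
  proof -
    have "of_int_vec w \<in> of_int_vec ` V"
      using that extreme_point_of_convex_hull unfolding V(2) adjacent_def is_vertex_def by metis
    then obtain w' where "w' \<in> V" "of_int_vec w = (of_int_vec w' :: real ^ 'n)"
      by auto
    moreover from this(2) have "w = w'"
      by (simp add: of_int_vec_def vec_eq_iff)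
    ultimately show ?thesis
      by simp
  qed
  then have "{w. adjacent P v w} \<subseteq> V"
    by blast
  then show ?thesis
    using V(1) by (rule finite_subset)
qed

theorem theorem1p4:
  fixes P :: "(real ^ 'n) set" and l v :: "int ^ 'n" and q0 :: complex
  assumes "lattice_polytope P"
    and "generic_positive l P"
    and "is_vertex P v"
    and "is_pole (rho P l v) q0"
  shows "\<exists>w. adjacent P v w \<and> q0 ^ nat \<bar>int_form l (primitive_vec (w - v))\<bar> = 1"
proof -
  define I where "I = {w. adjacent P v w}"
  define u where "u w = primitive_vec (w - v)" for w
  have "finite I"
    unfolding I_def using assms(1) by (rule finite_adjacent)
  have ne: "int_form l (w - v) \<noteq> 0" if "w \<in> I" for w
    using assms(2) that unfolding I_def generic_positive_def int_form_diff by fastforce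
  have "\<exists>d::int. d > 0 \<and> (\<forall>i. (w - v) $ i = d * u w $ i)" if "w \<in> I" for w
  proof -
    have "w - v \<noteq> 0"
      using ne[OF that] by (auto simp: int_form_def)
    then show ?thesis
      unfolding u_def using primitive_vec by metis
  qed
  then obtain d :: "int ^ 'n \<Rightarrow> int" where d: "\<And>w. w \<in> I \<Longrightarrow> d w > 0"
    "\<And>w i. w \<in> I \<Longrightarrow> (w - v) $ i = d w * u w $ i"
    by metis
  have "int_form l (w - v) = d w * int_form l (u w)" if "w \<in> I" for w
    unfolding int_form_def d(2)[OF that] by (simp add: sum_distrib_left mult_ac)
  \<comment> \<open>The exponents in the conclusion are therefore positive, and the equation for
    \<open>q0\<close> is a genuine root-of-unity condition.\<close>
  then have ne_u: "int_form l (u w) \<noteq> 0" if "w \<in> I" for w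
    using ne[OF that] that by auto
  have scale: "of_int_vec w - of_int_vec v = of_int (d w) *\<^sub>R (of_int_vec (u w) :: real ^ 'n)" if "w \<in> I" for w
    using d(2)[OF that]
    by (simp add: of_int_vec_def vec_eq_iff flip: of_int_mult of_int_diff)
  have "vertex_cone P v = gen_cone (\<lambda>w. of_int_vec w - of_int_vec v) I"
    by (simp add: vertex_cone_def gen_cone_def I_def)
  also have "\<dots> = gen_cone (\<lambda>w. of_int (d w) *\<^sub>R of_int_vec (u w)) I"
    unfolding gen_cone_def using scale by simp
  \<comment> \<open>The positive factors \<open>d w\<close> are absorbed by the coefficients. With
    primitive generators the denominator has the exponents \<lambda>(g(w - v)) instead of their
    multiples \<lambda>(w - v).\<close>
  also have "\<dots> = gen_cone (\<lambda>w. of_int_vec (u w)) I"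
    using d(1) by (intro gen_cone_rescale) auto
  finally have "rho P l v = (\<lambda>q. sigma (gen_cone (\<lambda>w. of_int_vec (u w)) I) (\<chi> j. q powi (l $ j)))"
    by (simp add: rho_def fun_eq_iff)
  then have "\<exists>w\<in>I. q0 ^ nat \<bar>int_form l (u w)\<bar> = 1"
    using pole_sigma_gen_cone[OF \<open>finite I\<close> ne_u] assms(4) by simp
  then show ?thesis
    by (auto simp: I_def u_def)
qed

end
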